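(* Let $G$ be a connected simple infinite graph. Then the tangle space $\Theta$ of $G$ is homeomorphic to the inverse limit $\mathcal P=\varprojlim(\mathcal P_\gamma\mid\gamma\in\Gamma)$ of finite discrete spaces.
   Context: $G=(V,E)$. $\mathcal X$ is the set of finite subsets of $V$, directed by inclusion. For $X\in\mathcal X$, $\mathcal C_X$ is the set of (graph) components of $G-X$ with the discrete topology; for $X\subseteq X'$ the map $\mathfrak c_{X',X}\colon\mathcal C_{X'}\to\mathcal C_X$ sends each component of $G-X'$ to the component of $G-X$ including it, and $\beta(\mathfrak c_{X',X})\colon\beta(\mathcal C_{X'})\to\beta(\mathcal C_X)$ is its continuous extension to Stone–Čech compactifications. The tangle space of $G$ is the compact Hausdorff space $\Theta=\varprojlim_{X\in\mathcal X}\beta(\mathcal C_X)$; its elements are called $\aleph_0$-tangles. $\Gamma$ is the set of all pairs $\gamma=(X,P)$ with $X\in\mathcal X$ and $P$ a finite partition of $\mathcal C_X$ (into non-empty classes). Write $X(\gamma)=X$ and $P(\gamma)=P$. For $X\subseteq X'\in\mathcal X$ and a finite partition $P$ of $\mathcal C_X$, let $P\downharpoonright X'=\{\mathfrak c_{X',X}^{-1}(\mathcal C)\mid\mathcal C\in P\}\setminus\{\emptyset\}$. Order $\Gamma$ by letting $(X,P)\le(Y,Q)$ if $X\subseteq Y$ and $Q$ refines $P\downharpoonright Y$; this makes $\Gamma$ a directed poset. For $\gamma\in\Gamma$, $\mathcal P_\gamma$ is the finite set $P(\gamma)$ with the discrete topology, and for $\gamma\le\gamma'$ the bonding map $f_{\gamma',\gamma}\colon\mathcal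 P_{\gamma'}\to\mathcal P_\gamma$ sends $\mathcal C'$ to the unique $\mathcal C\in\mathcal P_\gamma$ with $\{\mathfrak c_{X(\gamma'),X(\gamma)}(C)\mid C\in\mathcal C'\}\subseteq\mathcal C$. *)

theory Defs
  imports "HOL-Analysis.Analysis" "HOL-Library.Disjoint_Sets"
begin

section \<open>Simple graphs and their components\<close>

type_synonym 'v graph = "'v set \<times> 'v set set"

abbreviation verts :: "'v graph \<Rightarrow> 'v set" where "verts \<equiv> fst"
abbreviation edges :: "'v graph \<Rightarrow> 'v set set" where "edges \<equiv> snd"

definition simple_graph :: "'v graph \<Rightarrow> bool" where
  "simple_graph G \<longleftrightarrow> (\<forall>e\<in>edges G. e \<subseteq> verts G \<and> card e = 2)"

definition connected_graph :: "'v graph \<Rightarrow> bool" where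
  "connected_graph G \<longleftrightarrow> verts G \<noteq> {} \<and>
     (\<forall>u\<in>verts G. \<forall>v\<in>verts G. (\<lambda>x y. {x, y} \<in> edges G)\<^sup>*\<^sup>* u v)"

definition subgraph :: "'v graph \<Rightarrow> 'v graph \<Rightarrow> bool" where
  "subgraph H G \<longleftrightarrow> simple_graph H \<and> verts H \<subseteq> verts G \<and> edges H \<subseteq> edges G"

definition delete_verts :: "'v graph \<Rightarrow> 'v set \<Rightarrow> 'v graph" where
  "delete_verts G X = (verts G - X, {e \<in> edges G. e \<inter> X = {}})"

definition components_of_graph :: "'v graph \<Rightarrow> 'v graph set" where
  "components_of_graph G = {C. subgraph C G \<and> connected_graph C \<and>
     (\<forall>D. subgraph D G \<and> connected_graph D \<and> subgraph C D \<longrightarrow> D = C)}"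


section \<open>Inverse limits of topological spaces\<close>

text \<open>The bonding map from stage \<open>j\<close> to stage \<open>i\<close>, for \<open>le i j\<close>, is \<open>f j i\<close>.\<close>

definition inverse_limit ::
  "'i set \<Rightarrow> ('i \<Rightarrow> 'i \<Rightarrow> bool) \<Rightarrow> ('i \<Rightarrow> 'a topology) \<Rightarrow> ('i \<Rightarrow> 'i \<Rightarrow> 'a \<Rightarrow> 'a)
    \<Rightarrow> ('i \<Rightarrow> 'a) topology" where
  "inverse_limit I le T f =
     subtopology (product_topology T I) {x. \<forall>i\<in>I. \<forall>j\<in>I. le i j \<longrightarrow> f j i (x j) = x i}"


section \<open>Stone--Cech compactification\<close>

text \<open>
  The Stone--Cech compactification of \<open>X\<close> is the closure of the image of \<open>X\<close> under the
  evaluation map into the cube with one factor \<open>[0,1]\<close> for each continuous map \<open>X \<rightarrow> [0,1]\<close>.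
  These maps are taken to be extensional, so that each occurs exactly once as an index.
\<close>

definition unit_maps :: "'a topology \<Rightarrow> ('a \<Rightarrow> real) set" where
  "unit_maps X = {h \<in> extensional (topspace X). continuous_map X (top_of_set {0..1}) h}"

definition stone_cech_embed :: "'a topology \<Rightarrow> 'a \<Rightarrow> ('a \<Rightarrow> real) \<Rightarrow> real" where
  "stone_cech_embed X x = (\<lambda>h\<in>unit_maps X. h x)"

definition unit_cube :: "'a topology \<Rightarrow> (('a \<Rightarrow> real) \<Rightarrow> real) topology" where
  "unit_cube X = product_topology (\<lambda>h. top_of_set {0..1}) (unit_maps X)"

definition stone_cech :: "'a topology \<Rightarrow> (('a \<Rightarrow> real) \<Rightarrow> real) topology" where
  "stone_cech X = subtopology (unit_cube X)
     (unit_cube X closure_of (stone_cech_embed X ` topspace X))"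

text \<open>The continuous extension of a continuous map \<open>f\<close> from \<open>X\<close> to \<open>Y\<close>; it exists and is unique
  by \<open>stone_cech_map_ex1\<close> below.\<close>

definition stone_cech_map ::
  "'a topology \<Rightarrow> 'b topology \<Rightarrow> ('a \<Rightarrow> 'b) \<Rightarrow> (('a \<Rightarrow> real) \<Rightarrow> real) \<Rightarrow> (('b \<Rightarrow> real) \<Rightarrow> real)" where
  "stone_cech_map X Y f = (THE F. F \<in> extensional (topspace (stone_cech X)) \<and>
     continuous_map (stone_cech X) (stone_cech Y) F \<and>
     (\<forall>x\<in>topspace X. F (stone_cech_embed X x) = stone_cech_embed Y (f x)))"

lemma unit_maps_eq_cfunspace:
  "unit_maps X = mspace (submetric (cfunspace X euclidean_metric) {f. f \<in> topspace X \<rightarrow> {0..1}})"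
proof -
  have "bounded (h ` topspace X)" if "h \<in> topspace X \<rightarrow> {0..1::real}" for h
    by (meson bounded_closed_interval bounded_subset image_subset_iff_funcset that)
  then show ?thesis
    by (auto simp: unit_maps_def continuous_map_in_subtopology)
qed

lemma compact_space_unit_cube: "compact_space (unit_cube X)"
  unfolding unit_cube_def
  by (auto simp: compact_space_product_topology compact_space_subtopology)

lemma Hausdorff_space_unit_cube: "Hausdorff_space (unit_cube X)"
  unfolding unit_cube_def
  by (auto simp: Hausdorff_space_product_topology Hausdorff_space_subtopology)

lemma compact_space_stone_cech: "compact_space (stone_cech X)"
  unfolding stone_cech_def
  by (meson closedin_closure_of closedin_compact_space compact_space_subtopology
      compact_space_unit_cube)

lemma Hausdorff_space_stone_cech: "Hausdorff_space (stone_cech X)"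
  unfolding stone_cech_def by (simp add: Hausdorff_space_subtopology Hausdorff_space_unit_cube)

lemma stone_cech_embed_in_cube: "x \<in> topspace X \<Longrightarrow> stone_cech_embed X x \<in> topspace (unit_cube X)"
  by (auto simp: stone_cech_embed_def unit_cube_def unit_maps_def continuous_map_in_subtopology)

lemma topspace_stone_cech:
  "topspace (stone_cech X) = unit_cube X closure_of (stone_cech_embed X ` topspace X)"
  unfolding stone_cech_def
  by (metis closure_of_subset_topspace topspace_subtopology_subset)

lemma stone_cech_eq: "subtopology (unit_cube X) (topspace (stone_cech X)) = stone_cech X"
  by (simp only: topspace_stone_cech stone_cech_def[symmetric])

lemma stone_cech_embed_in: "x \<in> topspace X \<Longrightarrow> stone_cech_embed X x \<in> topspace (stone_cech X)"
  unfolding topspace_stone_cech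
  by (rule subsetD[OF closure_of_subset]) (auto simp: stone_cech_embed_in_cube)

lemma stone_cech_embed_dense:
  "stone_cech X closure_of (stone_cech_embed X ` topspace X) = topspace (stone_cech X)"
proof -
  have "stone_cech_embed X ` topspace X \<subseteq> topspace (stone_cech X)"
    by (auto intro: stone_cech_embed_in)
  then have "topspace (stone_cech X) \<inter> stone_cech_embed X ` topspace X = stone_cech_embed X ` topspace X"
    by blast
  then show ?thesis
    using closure_of_subtopology[of "unit_cube X" "topspace (stone_cech X)"
        "stone_cech_embed X ` topspace X"]
    by (simp add: topspace_stone_cech[symmetric] stone_cech_def[symmetric] stone_cech_eq)
qed

lemma continuous_map_stone_cech_embed: "continuous_map X (stone_cech X) (stone_cech_embed X)"
proof -
  have "continuous_map X (unit_cube X) (stone_cech_embed X)"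
    unfolding unit_cube_def continuous_map_componentwise
    by (auto simp: stone_cech_embed_def unit_maps_def)
  then show ?thesis
    using stone_cech_embed_in[of _ X]
    unfolding topspace_stone_cech unfolding stone_cech_def continuous_map_in_subtopology
    by blast
qed

lemma embedding_map_stone_cech_embed:
  assumes "completely_regular_space X" "Hausdorff_space X"
  shows "embedding_map X (stone_cech X) (stone_cech_embed X)"
proof -
  have "embedding_map X (unit_cube X) (stone_cech_embed X)"
    using completely_regular_space_cube_embedding_explicit[OF assms]
    unfolding unit_cube_def unit_maps_eq_cfunspace stone_cech_embed_def[abs_def] .
  then show ?thesis
    unfolding stone_cech_def
    by (auto simp: embedding_map_in_subtopology topspace_stone_cech[symmetric] 
        intro: stone_cech_embed_in)
qed

lemma stone_cech_map_unique:
  assumes "continuous_map (stone_cech X) Z F" "continuous_map (stone_cech X) Z G"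
    and "Hausdorff_space Z"
    and "\<And>x. x \<in> topspace X \<Longrightarrow> F (stone_cech_embed X x) = G (stone_cech_embed X x)"
    and "p \<in> topspace (stone_cech X)"
  shows "F p = G p"
  by (rule forall_in_closure_of_eq[of p "stone_cech X" "stone_cech_embed X ` topspace X" Z])
     (use assms stone_cech_embed_dense in auto)

lemma stone_cech_map_exists:
  assumes f: "continuous_map X Y f"
  shows "\<exists>F. continuous_map (stone_cech X) (stone_cech Y) F \<and>
     (\<forall>x\<in>topspace X. F (stone_cech_embed X x) = stone_cech_embed Y (f x))"
proof -
  define F where "F = (\<lambda>p :: ('a \<Rightarrow> real) \<Rightarrow> real. \<lambda>h\<in>unit_maps Y. p (restrict (h \<circ> f) (topspace X)))"
  have h: "restrict (h \<circ> f) (topspace X) \<in> unit_maps X" if "h \<in> unit_maps Y" for h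
    using that continuous_map_compose[OF f, of _ h]
    by (auto simp: unit_maps_def intro: continuous_map_eq)
  have cont: "continuous_map (unit_cube X) (unit_cube Y) F"
    unfolding unit_cube_def continuous_map_componentwise F_def
    using h by (auto intro: continuous_map_product_projection)
  have ext: "F (stone_cech_embed X x) = stone_cech_embed Y (f x)" if "x \<in> topspace X" for x
    using that h by (auto simp: F_def stone_cech_embed_def)
  have "F ` (unit_cube X closure_of (stone_cech_embed X ` topspace X))
      \<subseteq> unit_cube Y closure_of (F ` stone_cech_embed X ` topspace X)"
    by (rule continuous_map_image_closure_subset[OF cont])
  also have "\<dots> \<subseteq> unit_cube Y closure_of (stone_cech_embed Y ` topspace Y)"
    by (rule closure_of_mono) (use ext f in \<open>auto simp: continuous_map_def\<close>)
  finally have sub: "F ` topspace (stone_cech X) \<subseteq> unit_cube Y closure_of (stone_cech_embed Y ` topspace Y)"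
    by (simp add: topspace_stone_cech)
  have "continuous_map (stone_cech X) (unit_cube Y) F"
    using cont unfolding stone_cech_def by (rule continuous_map_from_subtopology)
  with sub have "continuous_map (stone_cech X) (stone_cech Y) F"
    unfolding stone_cech_def[of Y] continuous_map_in_subtopology by blast
  with ext show ?thesis by blast
qed

lemma stone_cech_map_ex1:
  assumes f: "continuous_map X Y f"
  shows "\<exists>!F. F \<in> extensional (topspace (stone_cech X)) \<and>
     continuous_map (stone_cech X) (stone_cech Y) F \<and>
     (\<forall>x\<in>topspace X. F (stone_cech_embed X x) = stone_cech_embed Y (f x))"
proof -
  obtain F where F: "continuous_map (stone_cech X) (stone_cech Y) F"
     "\<And>x. x \<in> topspace X \<Longrightarrow> F (stone_cech_embed X x) = stone_cech_embed Y (f x)"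
    using stone_cech_map_exists[OF f] by blast
  show ?thesis
  proof (rule ex1I[of _ "restrict F (topspace (stone_cech X))"])
    show "restrict F (topspace (stone_cech X)) \<in> extensional (topspace (stone_cech X)) \<and>
      continuous_map (stone_cech X) (stone_cech Y) (restrict F (topspace (stone_cech X))) \<and>
      (\<forall>x\<in>topspace X. restrict F (topspace (stone_cech X)) (stone_cech_embed X x)
         = stone_cech_embed Y (f x))"
      using F by (auto simp: stone_cech_embed_in intro: continuous_map_eq)
  next
    fix G
    assume G: "G \<in> extensional (topspace (stone_cech X)) \<and>
      continuous_map (stone_cech X) (stone_cech Y) G \<and>
      (\<forall>x\<in>topspace X. G (stone_cech_embed X x) = stone_cech_embed Y (f x))"
    have "G p = F p" if "p \<in> topspace (stone_cech X)" for p
      by (rule stone_cech_map_unique[OF _ F(1) Hausdorff_space_stone_cech _ that])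
         (use G F in auto)
    with G show "G = restrict F (topspace (stone_cech X))"
      by (auto simp: extensional_def restrict_def)
  qed
qed

theorem stone_cech_universal:
  assumes f: "continuous_map X K f" and K: "compact_space K" "Hausdorff_space K"
  shows "\<exists>F. continuous_map (stone_cech X) K F \<and>
     (\<forall>x\<in>topspace X. F (stone_cech_embed X x) = f x)"
proof -
  obtain F where F: "continuous_map (stone_cech X) (stone_cech K) F"
     "\<And>x. x \<in> topspace X \<Longrightarrow> F (stone_cech_embed X x) = stone_cech_embed K (f x)"
    using stone_cech_map_exists[OF f] by blast
  have "completely_regular_space K"
    using K compact_Hausdorff_or_regular_imp_normal_space normal_imp_completely_regular_space
    by blast
  then have emb: "embedding_map K (stone_cech K) (stone_cech_embed K)"
    using K(2) by (rule embedding_map_stone_cech_embed)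
  have "compactin (stone_cech K) (stone_cech_embed K ` topspace K)"
    using K(1) continuous_map_stone_cech_embed compact_space_def image_compactin by blast
  then have "closedin (stone_cech K) (stone_cech_embed K ` topspace K)"
    by (rule compactin_imp_closedin[OF Hausdorff_space_stone_cech])
  then have "stone_cech_embed K ` topspace K = topspace (stone_cech K)"
    using stone_cech_embed_dense[of K] by (simp add: closure_of_closedin)
  with emb have "homeomorphic_map K (stone_cech K) (stone_cech_embed K)"
    by (simp add: embedding_map_def)
  then obtain e where e: "homeomorphic_maps K (stone_cech K) (stone_cech_embed K) e"
    using homeomorphic_map_maps by blast
  have "continuous_map (stone_cech X) K (e \<circ> F)"
    using F(1) e by (auto simp: homeomorphic_maps_def intro: continuous_map_compose)
  moreover have "(e \<circ> F) (stone_cech_embed X x) = f x" if "x \<in> topspace X" for x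
    using that F(2) e f by (auto simp: homeomorphic_maps_def continuous_map_def)
  ultimately show ?thesis by blast
qed


section \<open>The tangle space\<close>

definition finite_vertex_sets :: "'v graph \<Rightarrow> 'v set set" where
  "finite_vertex_sets G = {X. finite X \<and> X \<subseteq> verts G}"

definition comps :: "'v graph \<Rightarrow> 'v set \<Rightarrow> 'v graph set" where
  "comps G X = components_of_graph (delete_verts G X)"

definition comp_map :: "'v graph \<Rightarrow> 'v set \<Rightarrow> 'v set \<Rightarrow> 'v graph \<Rightarrow> 'v graph" where
  "comp_map G X' X D = (THE C. C \<in> comps G X \<and> subgraph D C)"

definition tangle_space :: "'v graph \<Rightarrow> ('v set \<Rightarrow> ('v graph \<Rightarrow> real) \<Rightarrow> real) topology" where
  "tangle_space G = inverse_limit (finite_vertex_sets G) (\<subseteq>)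
     (\<lambda>X. stone_cech (discrete_topology (comps G X)))
     (\<lambda>X' X. stone_cech_map (discrete_topology (comps G X')) (discrete_topology (comps G X))
        (comp_map G X' X))"

section \<open>The inverse system of finite partitions\<close>

definition Gamma :: "'v graph \<Rightarrow> ('v set \<times> 'v graph set set) set" where
  "Gamma G = {(X, P). X \<in> finite_vertex_sets G \<and> finite P \<and> partition_on (comps G X) P}"

definition restrict_partition ::
  "'v graph \<Rightarrow> 'v set \<Rightarrow> 'v graph set set \<Rightarrow> 'v set \<Rightarrow> 'v graph set set" where
  "restrict_partition G X P X' = {comp_map G X' X -` \<C> \<inter> comps G X' | \<C>. \<C> \<in> P} - {{}}"

definition Gamma_le ::
  "'v graph \<Rightarrow> 'v set \<times> 'v graph set set \<Rightarrow> 'v set \<times> 'v graph set set \<Rightarrow> bool" where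
  "Gamma_le G = (\<lambda>(X, P) (Y, Q). X \<subseteq> Y \<and> refines (comps G Y) Q (restrict_partition G X P Y))"

definition partition_bond ::
  "'v graph \<Rightarrow> 'v set \<times> 'v graph set set \<Rightarrow> 'v set \<times> 'v graph set set
    \<Rightarrow> 'v graph set \<Rightarrow> 'v graph set" where
  "partition_bond G \<gamma>' \<gamma> \<C>' = (THE \<C>. \<C> \<in> snd \<gamma> \<and> comp_map G (fst \<gamma>') (fst \<gamma>) ` \<C>' \<subseteq> \<C>)"

definition partition_limit ::
  "'v graph \<Rightarrow> ('v set \<times> 'v graph set set \<Rightarrow> 'v graph set) topology" where
  "partition_limit G = inverse_limit (Gamma G) (Gamma_le G)
     (\<lambda>\<gamma>. discrete_topology (snd \<gamma>)) (partition_bond G)"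


text \<open>The definite descriptions in \<open>comp_map\<close> and \<open>partition_bond\<close> are well defined.\<close>

lemma components_of_graph_ex1:
  assumes G: "simple_graph G" and D: "subgraph D G" "connected_graph D"
  shows "\<exists>!C. C \<in> components_of_graph G \<and> subgraph D C"
proof -
  obtain d where d: "d \<in> verts D" using D(2) by (auto simp: connected_graph_def)
  define r where "r = (\<lambda>x y. {x, y} \<in> edges G)"
  define W where "W = {v. r\<^sup>*\<^sup>* d v}"
  define C where "C = (W, {e \<in> edges G. e \<subseteq> W})"
  have sub: "subgraph H C" if H: "subgraph H G" "connected_graph H" "d \<in> verts H" for H
  proof -
    have "r\<^sup>*\<^sup>* d v" if "v \<in> verts H" for v
    proof -
      have "(\<lambda>x y. {x, y} \<in> edges H)\<^sup>*\<^sup>* d v"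
        using H that by (auto simp: connected_graph_def)
      then show ?thesis
        by (rule rtranclp_mono[THEN predicate2D, rotated])
           (use H in \<open>auto simp: subgraph_def r_def\<close>)
    qed
    then show ?thesis using H
      by (auto simp: subgraph_def simple_graph_def C_def W_def)
  qed
  have WG: "W \<subseteq> verts G"
  proof
    fix v assume "v \<in> W"
    then have "r\<^sup>*\<^sup>* d v" by (simp add: W_def)
    then show "v \<in> verts G"
      by induction (use d D G in \<open>auto simp: subgraph_def simple_graph_def r_def\<close>)
  qed
  have CG: "subgraph C G"
    using G WG by (auto simp: subgraph_def simple_graph_def C_def)
  have dC: "(\<lambda>x y. {x, y} \<in> edges C)\<^sup>*\<^sup>* d v" if "r\<^sup>*\<^sup>* d v" for v
    using that
  proof induction
    case (step y z)
    then have "r\<^sup>*\<^sup>* d z" by (meson rtranclp.rtrancl_into_rtrancl)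
    with step have "{y, z} \<in> edges C" by (auto simp: C_def W_def r_def)
    with step show ?case by (meson rtranclp.rtrancl_into_rtrancl)
  qed auto
  have sym: "symp (\<lambda>x y. {x, y} \<in> edges C)" by (auto simp: symp_def insert_commute)
  have conC: "connected_graph C"
    unfolding connected_graph_def
  proof (intro conjI ballI)
    show "verts C \<noteq> {}" by (auto simp: C_def W_def)
    fix u v assume "u \<in> verts C" "v \<in> verts C"
    then have "r\<^sup>*\<^sup>* d u" "r\<^sup>*\<^sup>* d v" by (auto simp: C_def W_def)
    then show "(\<lambda>x y. {x, y} \<in> edges C)\<^sup>*\<^sup>* u v"
      using dC sympD[OF symp_rtranclp[OF sym]] by (meson rtranclp_trans)
  qed
  have dinC: "d \<in> verts C" by (simp add: C_def W_def)
  have "C \<in> components_of_graph G"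
    unfolding components_of_graph_def
  proof (intro CollectI conjI allI impI CG conC)
    fix H assume H: "subgraph H G \<and> connected_graph H \<and> subgraph C H"
    then have "d \<in> verts H" using dinC unfolding subgraph_def by blast
    with H sub have "subgraph H C" by blast
    with H show "H = C" by (auto simp: subgraph_def prod_eq_iff)
  qed
  moreover have "subgraph D C" using sub D d by blast
  moreover have "C' = C" if "C' \<in> components_of_graph G" "subgraph D C'" for C'
  proof -
    have "d \<in> verts C'" using that(2) d unfolding subgraph_def by blast
    with that(1) sub have "subgraph C' C" unfolding components_of_graph_def by blast
    with that(1) CG conC show ?thesis unfolding components_of_graph_def by blast
  qed
  ultimately show ?thesis by blast
qed

lemma comp_map_ex1:
  assumes G: "simple_graph G" and XX': "X \<subseteq> X'" and D: "D \<in> comps G X'"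
  shows "\<exists>!C. C \<in> comps G X \<and> subgraph D C"
proof -
  have D': "subgraph D (delete_verts G X')" "connected_graph D"
    using D unfolding comps_def components_of_graph_def by blast+
  have "verts (delete_verts G X') \<subseteq> verts (delete_verts G X)"
    "edges (delete_verts G X') \<subseteq> edges (delete_verts G X)"
    using XX' unfolding delete_verts_def by auto
  then have "subgraph D (delete_verts G X)"
    using D'(1) unfolding subgraph_def by blast
  moreover have "simple_graph (delete_verts G X)"
    using G unfolding simple_graph_def delete_verts_def by auto
  ultimately show ?thesis
    using D'(2) unfolding comps_def by (intro components_of_graph_ex1)
qed

lemma partition_bond_ex1:
  assumes \<gamma>: "\<gamma> \<in> Gamma G" "\<gamma>' \<in> Gamma G" "Gamma_le G \<gamma> \<gamma>'"
    and C': "\<C>' \<in> snd \<gamma>'"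
  shows "\<exists>!\<C>. \<C> \<in> snd \<gamma> \<and> comp_map G (fst \<gamma>') (fst \<gamma>) ` \<C>' \<subseteq> \<C>"
proof -
  obtain X P Y Q where eq: "\<gamma> = (X, P)" "\<gamma>' = (Y, Q)" by (cases \<gamma>, cases \<gamma>')
  have P: "partition_on (comps G X) P" and Q: "partition_on (comps G Y) Q"
    using \<gamma>(1,2) unfolding Gamma_def eq mem_Collect_eq prod.case by blast+
  have ref: "refines (comps G Y) Q (restrict_partition G X P Y)"
    using \<gamma>(3) unfolding Gamma_le_def eq prod.case by blast
  have "\<C>' \<noteq> {}" using C' Q unfolding eq partition_on_def snd_conv by blast
  obtain \<C> where "\<C> \<in> P" "\<C>' \<subseteq> comp_map G Y X -` \<C> \<inter> comps G Y"
  proof -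
    have "\<C>' \<in> Q" using C' unfolding eq snd_conv .
    with ref obtain B where "B \<in> restrict_partition G X P Y" "\<C>' \<subseteq> B"
      unfolding refines_def by blast
    moreover then obtain \<C> where "\<C> \<in> P" "B = comp_map G Y X -` \<C> \<inter> comps G Y"
      unfolding restrict_partition_def by blast
    ultimately show thesis using that[of \<C>] by simp
  qed
  then have 1: "\<C> \<in> P \<and> comp_map G Y X ` \<C>' \<subseteq> \<C>" by blast
  moreover have "\<D> = \<C>" if "\<D> \<in> P \<and> comp_map G Y X ` \<C>' \<subseteq> \<D>" for \<D>
  proof -
    obtain D where "D \<in> \<C>'" using \<open>\<C>' \<noteq> {}\<close> by blast
    then have "comp_map G Y X D \<in> \<D> \<inter> \<C>" using that 1 by blast
    then have "\<D> \<inter> \<C> \<noteq> {}" by blast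
    moreover have "\<D> \<in> P" "\<C> \<in> P" "disjoint P" 
      using that 1 P unfolding partition_on_def by blast+
    ultimately show ?thesis using disjointD[of P \<D> \<C>] by blast
  qed
  ultimately show ?thesis unfolding eq fst_conv snd_conv by (rule ex1I)
qed

end

theory Submission
  imports Defs
begin

text \<open>
  A point of the Stone--Cech compactification of a discrete space \<open>S\<close> is an ultrafilter on \<open>S\<close>,
  that is, a coherent choice of one block from every finite partition of \<open>S\<close>. This is the whole
  reason for the theorem: a tangle chooses an ultrafilter on the components of \<open>G - X\<close> for each
  finite \<open>X\<close>, compatibly with the bonding maps, and a point of the inverse limit of the finite
  spaces of partition classes records exactly the corresponding choices of blocks.

  Ultrafilters do not appear explicitly. A point \<open>p\<close> chooses the block \<open>A\<close> of a finite partition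
  if \<open>p\<close> lies in the closure of the image of \<open>A\<close>. These closures are clopen, and those of disjoint
  sets are disjoint, so that the choice is unique (\<open>block_closure_ex1\<close>) and depends continuously
  on \<open>p\<close>. Distinct points are separated by a partition into two blocks
  (\<open>block_closure_separates\<close>), and by compactness every coherent choice comes from a point
  (\<open>coherent_choice_realized\<close>). Hence sending a tangle to its choices is a continuous bijection
  from a compact space onto a Hausdorff space, which is a homeomorphism.
\<close>

section \<open>Inverse limits of compact Hausdorff spaces\<close>

lemma topspace_inverse_limit:
  "topspace (inverse_limit I le T f) =
     {x \<in> \<Pi>\<^sub>E i\<in>I. topspace (T i). \<forall>i\<in>I. \<forall>j\<in>I. le i j \<longrightarrow> f j i (x j) = x i}"
  by (auto simp: inverse_limit_def)

lemma Hausdorff_space_inverse_limit: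
  assumes "\<And>i. i \<in> I \<Longrightarrow> Hausdorff_space (T i)"
  shows "Hausdorff_space (inverse_limit I le T f)"
  unfolding inverse_limit_def
  by (intro Hausdorff_space_subtopology) (use assms in \<open>simp add: Hausdorff_space_product_topology\<close>)

lemma continuous_map_inverse_limit_projection:
  assumes "i \<in> I"
  shows "continuous_map (inverse_limit I le T f) (T i) (\<lambda>x. x i)"
  unfolding inverse_limit_def
  by (intro continuous_map_from_subtopology continuous_map_product_projection assms)

text \<open>The compatible families form a closed subset of the compact product, because each
  compatibility condition equates two continuous maps into a Hausdorff space.\<close>

lemma compact_space_inverse_limit:
  assumes comp: "\<And>i. i \<in> I \<Longrightarrow> compact_space (T i)"
    and haus: "\<And>i. i \<in> I \<Longrightarrow> Hausdorff_space (T i)"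
    and cont: "\<And>i j. i \<in> I \<Longrightarrow> j \<in> I \<Longrightarrow> le i j \<Longrightarrow> continuous_map (T j) (T i) (f j i)"
  shows "compact_space (inverse_limit I le T f)"
proof -
  let ?\<Pi> = "product_topology T I"
  define E where "E = (\<lambda>(i, j). {x \<in> topspace ?\<Pi>. f j i (x j) = x i})"
  let ?J = "{(i, j). i \<in> I \<and> j \<in> I \<and> le i j}"
  have "closedin ?\<Pi> (E ij)" if "ij \<in> ?J" for ij
  proof -
    obtain i j where ij: "ij = (i, j)" "i \<in> I" "j \<in> I" "le i j"
      using \<open>ij \<in> ?J\<close> by blast
    have "continuous_map ?\<Pi> (T i) (\<lambda>x. f j i (x j))"
      using continuous_map_compose
        [OF continuous_map_product_projection[where X = T, OF ij(3)] cont[OF ij(2-4)]]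
      by (simp add: o_def)
    then show ?thesis
      unfolding ij(1) E_def prod.case
      by (intro closedin_continuous_maps_eq[OF haus[OF ij(2)]]
          continuous_map_product_projection ij(2))
  qed
  then have "closedin ?\<Pi> (\<Inter>(insert (topspace ?\<Pi>) (E ` ?J)))"
    by (intro closedin_Inter) (blast intro: closedin_topspace)+
  moreover have "inverse_limit I le T f =
      subtopology ?\<Pi> (\<Inter>(insert (topspace ?\<Pi>) (E ` ?J)))"
    unfolding inverse_limit_def
    by (subst subtopology_restrict[symmetric])
      (rule arg_cong[where f = "subtopology _"], auto simp: E_def)
  moreover have "compact_space ?\<Pi>"
    using comp by (simp add: compact_space_product_topology)
  ultimately show ?thesis
    by (simp only: compact_space_subtopology closedin_compact_space)
qed


section \<open>Points of the Stone--Cech compactification of a discrete space\<close>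

text \<open>In terms of ultrafilters on \<open>S\<close>, this is the set of those that contain \<open>A\<close>.\<close>

definition block_closure :: "'a set \<Rightarrow> 'a set \<Rightarrow> (('a \<Rightarrow> real) \<Rightarrow> real) set" where
  "block_closure S A =
     stone_cech (discrete_topology S) closure_of (stone_cech_embed (discrete_topology S) ` A)"

lemma closedin_block_closure: "closedin (stone_cech (discrete_topology S)) (block_closure S A)"
  by (simp add: block_closure_def)

lemma block_closure_subset: "block_closure S A \<subseteq> topspace (stone_cech (discrete_topology S))"
  by (simp add: block_closure_def closure_of_subset_topspace)

lemma block_closure_mono: "A \<subseteq> B \<Longrightarrow> block_closure S A \<subseteq> block_closure S B"
  unfolding block_closure_def by (intro closure_of_mono image_mono)

lemma block_closure_nonempty:
  assumes "A \<subseteq> S" "A \<noteq> {}"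
  shows "block_closure S A \<noteq> {}"
proof -
  have "stone_cech_embed (discrete_topology S) ` A \<subseteq> block_closure S A"
    unfolding block_closure_def
    using assms(1) stone_cech_embed_in[of _ "discrete_topology S"]
    by (intro closure_of_subset) auto
  with assms(2) show ?thesis by blast
qed

lemma unit_maps_discrete:
  "unit_maps (discrete_topology S) = {h \<in> extensional S. h \<in> S \<rightarrow> {0..1}}"
  by (auto simp: unit_maps_def)

text \<open>Points are families of values of the maps from \<open>S\<close> to \<open>[0,1]\<close>, and the value at \<open>h\<close> depends
  continuously on the point. So any closed condition that \<open>h\<close> satisfies on \<open>A\<close> passes to the
  closure of \<open>A\<close>.\<close>

lemma block_closure_value:
  assumes h: "h \<in> unit_maps (discrete_topology S)" and "A \<subseteq> S" and p: "p \<in> block_closure S A"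
    and K: "closed K" "h ` A \<subseteq> K"
  shows "p h \<in> K"
proof (rule forall_in_closure_of[OF p[unfolded block_closure_def]])
  show "x h \<in> K" if "x \<in> stone_cech_embed (discrete_topology S) ` A" for x
    using that h K(2) by (auto simp: stone_cech_embed_def)
  have "continuous_map (unit_cube (discrete_topology S)) (top_of_set {0..1}) (\<lambda>p. p h)"
    unfolding unit_cube_def by (rule continuous_map_product_projection[OF h])
  then have "continuous_map (stone_cech (discrete_topology S)) euclideanreal (\<lambda>p. p h)"
    unfolding stone_cech_def
    by (intro continuous_map_from_subtopology) (rule continuous_map_into_fulltopology)
  then show "closedin (stone_cech (discrete_topology S))
      {x \<in> topspace (stone_cech (discrete_topology S)). x h \<in> K}"
    using K(1) by (intro closedin_continuous_map_preimage) auto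
qed

text \<open>The indicator function of \<open>A\<close> has value \<open>1\<close> on the closure of \<open>A\<close> and value \<open>0\<close> on that
  of \<open>B\<close>.\<close>

lemma block_closure_disjoint:
  assumes "A \<subseteq> S" "B \<subseteq> S" "A \<inter> B = {}"
  shows "block_closure S A \<inter> block_closure S B = {}"
proof -
  define h :: "'a \<Rightarrow> real" where "h = (\<lambda>x\<in>S. if x \<in> A then 1 else 0)"
  have h: "h \<in> unit_maps (discrete_topology S)"
    by (auto simp: unit_maps_discrete h_def)
  have "p h = 1" if "p \<in> block_closure S A" for p
    using block_closure_value[OF h assms(1) that, of "{1}"] assms by (auto simp: h_def)
  moreover have "p h = 0" if "p \<in> block_closure S B" for p
    using block_closure_value[OF h assms(2) that, of "{0}"] assms by (auto simp: h_def)
  ultimately show ?thesis by fastforce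
qed

lemma block_closure_Union:
  assumes "finite P" "\<Union>P = S"
  shows "(\<Union>A\<in>P. block_closure S A) = topspace (stone_cech (discrete_topology S))"
proof -
  have "(\<Union>A\<in>P. block_closure S A) = stone_cech (discrete_topology S) closure_of
      (\<Union>A\<in>P. stone_cech_embed (discrete_topology S) ` A)"
    using assms(1) by (simp add: block_closure_def closure_of_Union)
  also have "(\<Union>A\<in>P. stone_cech_embed (discrete_topology S) ` A) =
      stone_cech_embed (discrete_topology S) ` topspace (discrete_topology S)"
    using assms(2) by auto
  finally show ?thesis by (simp only: stone_cech_embed_dense)
qed

lemma block_closure_Diff:
  assumes "A \<subseteq> S"
  shows "block_closure S (S - A) = topspace (stone_cech (discrete_topology S)) - block_closure S A"
  using block_closure_Union[of "{A, S - A}" S] block_closure_disjoint[of A S "S - A"] assms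
  by auto

lemma openin_block_closure:
  assumes "A \<subseteq> S"
  shows "openin (stone_cech (discrete_topology S)) (block_closure S A)"
  using closedin_block_closure[of S "S - A"] block_closure_subset[of S A]
  by (simp add: block_closure_Diff[OF assms] openin_closedin_eq)

lemma block_closure_ex1:
  assumes P: "finite P" "partition_on S P" and p: "p \<in> topspace (stone_cech (discrete_topology S))"
  shows "\<exists>!A. A \<in> P \<and> p \<in> block_closure S A"
proof -
  have "\<Union>P = S" using P(2) by (simp add: partition_on_def)
  then obtain A where "A \<in> P" "p \<in> block_closure S A"
    using block_closure_Union[OF P(1)] p by blast
  moreover have "B = A" if "B \<in> P" "p \<in> block_closure S B" for B
  proof (rule ccontr)
    assume "B \<noteq> A"
    then have "B \<inter> A = {}"
      using partition_onD2[OF P(2)] that(1) \<open>A \<in> P\<close> disjointD by blast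
    then have "block_closure S B \<inter> block_closure S A = {}"
      using \<open>\<Union>P = S\<close> that(1) \<open>A \<in> P\<close> by (intro block_closure_disjoint) auto
    with that(2) \<open>p \<in> block_closure S A\<close> show False by blast
  qed
  ultimately show ?thesis by blast
qed

lemma two_block_partition:
  assumes "A \<subseteq> S"
  shows "finite ({A, S - A} - {{}})" "partition_on S ({A, S - A} - {{}})"
  using assms by (auto simp: partition_on_def disjoint_def)

text \<open>If \<open>p\<close> and \<open>q\<close> differ at a map \<open>h\<close>, then for a number \<open>r\<close> strictly between the two values,
  the points of \<open>S\<close> at which \<open>h\<close> is less than \<open>r\<close> and the remaining ones separate \<open>p\<close> from
  \<open>q\<close>.\<close>

lemma block_closure_separates:
  assumes p: "p \<in> topspace (stone_cech (discrete_topology S))"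
    and q: "q \<in> topspace (stone_cech (discrete_topology S))" and "p \<noteq> q"
  obtains A where "A \<subseteq> S" "p \<in> block_closure S A" "q \<in> block_closure S (S - A)"
proof -
  have sep: "\<exists>A\<subseteq>S. p \<in> block_closure S A \<and> q \<in> block_closure S (S - A)"
    if p: "p \<in> topspace (stone_cech (discrete_topology S))"
      and q: "q \<in> topspace (stone_cech (discrete_topology S))"
      and h: "h \<in> unit_maps (discrete_topology S)" and "p h < q h" for p q h
  proof -
    obtain r where r: "p h < r" "r < q h" using \<open>p h < q h\<close> dense by blast
    define A where "A = {x \<in> S. h x < r}"
    have A: "A \<subseteq> S" by (auto simp: A_def)
    have "h ` (S - A) \<subseteq> {r..}" by (auto simp: A_def)
    then have "p \<notin> block_closure S (S - A)"
      using block_closure_value[OF h, of "S - A" p "{r..}"] r(1) by auto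
    then have "p \<in> block_closure S A" using p by (simp add: block_closure_Diff[OF A])
    moreover have "h ` A \<subseteq> {..r}" by (auto simp: A_def)
    then have "q \<notin> block_closure S A"
      using block_closure_value[OF h A, of q "{..r}"] r(2) by auto
    then have "q \<in> block_closure S (S - A)" using q by (simp add: block_closure_Diff[OF A])
    ultimately show ?thesis using A by blast
  qed
  have "topspace (stone_cech (discrete_topology S)) \<subseteq>
      extensional (unit_maps (discrete_topology S))"
    unfolding stone_cech_def unit_cube_def by (auto simp: PiE_def)
  then obtain h where h: "h \<in> unit_maps (discrete_topology S)" "p h \<noteq> q h"
    using p q \<open>p \<noteq> q\<close> extensionalityI[of p _ q] by blast
  then consider "p h < q h" | "q h < p h" by linarith
  then show thesis
  proof cases
    case 1
    then show thesis using sep[OF p q h(1)] that by blast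
  next
    case 2
    then obtain A where "A \<subseteq> S" "q \<in> block_closure S A" "p \<in> block_closure S (S - A)"
      using sep[OF q p h(1)] by blast
    then show thesis using that[of "S - A"] by (simp add: double_diff)
  qed
qed

lemma eq_if_same_block_closures:
  assumes p: "p \<in> topspace (stone_cech (discrete_topology S))"
    and q: "q \<in> topspace (stone_cech (discrete_topology S))"
    and same: "\<And>P. finite P \<Longrightarrow> partition_on S P \<Longrightarrow>
      \<exists>A\<in>P. p \<in> block_closure S A \<and> q \<in> block_closure S A"
  shows "p = q"
proof (rule ccontr)
  assume "p \<noteq> q"
  then obtain A where A: "A \<subseteq> S" "p \<in> block_closure S A" "q \<in> block_closure S (S - A)"
    using block_closure_separates[OF p q] by blast
  have "block_closure S A \<inter> block_closure S (S - A) = {}"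
    using A(1) by (intro block_closure_disjoint) auto
  then show False using same[OF two_block_partition[OF A(1)]] A(2,3) by blast
qed

text \<open>The closures of the chosen blocks have the finite intersection property: finitely many
  partitions have a common refinement, and its chosen block lies in each of theirs.\<close>

lemma coherent_choice_realized:
  assumes c: "\<And>P. finite P \<Longrightarrow> partition_on S P \<Longrightarrow> c P \<in> P"
    and mono: "\<And>P R. finite P \<Longrightarrow> finite R \<Longrightarrow> refines S R P \<Longrightarrow> c R \<subseteq> c P"
  obtains p where "p \<in> topspace (stone_cech (discrete_topology S))"
    "\<And>P. finite P \<Longrightarrow> partition_on S P \<Longrightarrow> p \<in> block_closure S (c P)"
proof -
  define \<F> where "\<F> = {P. finite P \<and> partition_on S P}"
  have "\<Inter>\<K> \<noteq> {}" if K: "finite \<K>" "\<K> \<subseteq> (\<lambda>P. block_closure S (c P)) ` \<F>" for \<K>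
  proof (cases "\<K> = {}")
    case False
    obtain \<P> where \<P>: "\<P> \<subseteq> \<F>" "finite \<P>" "\<K> = (\<lambda>P. block_closure S (c P)) ` \<P>"
      using finite_subset_image[OF K] by auto
    define R where "R = common_refinement \<P>"
    have part: "partition_on S P" if "P \<in> \<P>" for P using that \<P>(1) by (auto simp: \<F>_def)
    have R: "finite R" "partition_on S R"
      using \<P> False part unfolding R_def \<F>_def
      by (auto intro!: finite_common_refinement partition_on_common_refinement)
    have "c R \<in> R" by (rule c[OF R])
    then have "c R \<subseteq> S" "c R \<noteq> {}" using R(2) by (auto simp: partition_on_def)
    moreover have "c R \<subseteq> c P" if "P \<in> \<P>" for P
    proof (rule mono)
      show "refines S R P" unfolding R_def by (rule refines_common_refinement[OF part that])
    qed (use R(1) that \<P>(1) in \<open>auto simp: \<F>_def\<close>)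
    then have "block_closure S (c R) \<subseteq> \<Inter>\<K>"
      unfolding \<P>(3) by (auto dest: block_closure_mono[of _ _ S])
    ultimately show ?thesis using block_closure_nonempty by blast
  qed simp
  then have "\<Inter>((\<lambda>P. block_closure S (c P)) ` \<F>) \<noteq> {}"
    by (intro compact_space_fip[THEN iffD1, rule_format,
          OF compact_space_stone_cech[of "discrete_topology S"]])
      (auto intro: closedin_block_closure)
  then obtain p where p: "\<And>P. P \<in> \<F> \<Longrightarrow> p \<in> block_closure S (c P)" by blast
  \<comment> \<open>Some partition is needed to see that \<open>p\<close> lies in the space at all.\<close>
  have "{S, S - S} - {{}} \<in> \<F>" using two_block_partition[of S S] by (simp add: \<F>_def)
  then have "p \<in> topspace (stone_cech (discrete_topology S))"
    using p block_closure_subset by blast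
  with p that show thesis by (auto simp: \<F>_def)
qed

lemma stone_cech_map_discrete:
  assumes "g \<in> S \<rightarrow> S'"
  shows "continuous_map (stone_cech (discrete_topology S)) (stone_cech (discrete_topology S'))
      (stone_cech_map (discrete_topology S) (discrete_topology S') g)"
    and "\<And>x. x \<in> S \<Longrightarrow> stone_cech_map (discrete_topology S) (discrete_topology S') g
        (stone_cech_embed (discrete_topology S) x) = stone_cech_embed (discrete_topology S') (g x)"
proof -
  have "continuous_map (discrete_topology S) (discrete_topology S') g" using assms by simp
  from theI'[OF stone_cech_map_ex1[OF this], folded stone_cech_map_def]
  show "continuous_map (stone_cech (discrete_topology S)) (stone_cech (discrete_topology S'))
      (stone_cech_map (discrete_topology S) (discrete_topology S') g)"
    "\<And>x. x \<in> S \<Longrightarrow> stone_cech_map (discrete_topology S) (discrete_topology S') g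
        (stone_cech_embed (discrete_topology S) x) = stone_cech_embed (discrete_topology S') (g x)"
    by auto
qed

lemma stone_cech_map_block_closure:
  assumes g: "g \<in> S \<rightarrow> S'" and "A \<subseteq> S" "g ` A \<subseteq> B" and p: "p \<in> block_closure S A"
  shows "stone_cech_map (discrete_topology S) (discrete_topology S') g p \<in> block_closure S' B"
proof -
  let ?F = "stone_cech_map (discrete_topology S) (discrete_topology S') g"
  have "?F p \<in> stone_cech (discrete_topology S') closure_of
      (?F ` stone_cech_embed (discrete_topology S) ` A)"
    using continuous_map_image_closure_subset[OF stone_cech_map_discrete(1)[OF g]] p
    unfolding block_closure_def by blast
  also have "?F ` stone_cech_embed (discrete_topology S) ` A =
      stone_cech_embed (discrete_topology S') ` g ` A"
    using stone_cech_map_discrete(2)[OF g] \<open>A \<subseteq> S\<close> by (force simp: image_image)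
  finally show ?thesis
    using block_closure_mono[OF \<open>g ` A \<subseteq> B\<close>] unfolding block_closure_def by blast
qed


section \<open>The order on finite partitions of component sets\<close>

lemma comp_map_in:
  assumes "simple_graph G" "X \<subseteq> Y"
  shows "comp_map G Y X \<in> comps G Y \<rightarrow> comps G X"
  using theI'[OF comp_map_ex1[OF assms]] unfolding comp_map_def by blast

lemma comp_map_same:
  assumes "simple_graph G" "D \<in> comps G X"
  shows "comp_map G X X D = D"
  unfolding comp_map_def
proof (rule the1_equality[OF comp_map_ex1[OF assms(1) order_refl assms(2)]])
  show "D \<in> comps G X \<and> subgraph D D"
    using assms(2) by (auto simp: comps_def components_of_graph_def subgraph_def)
qed

lemma restrict_partition_image:
  "restrict_partition G X P Y = (\<lambda>A. comp_map G Y X -` A \<inter> comps G Y) ` P - {{}}"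
  unfolding restrict_partition_def by blast

lemma restrict_partition_same:
  assumes "simple_graph G" "partition_on (comps G X) P"
  shows "restrict_partition G X P X = P"
proof -
  have "comp_map G X X -` A \<inter> comps G X = A" if "A \<in> P" for A
  proof -
    have "A \<subseteq> comps G X" using that partition_onD1[OF assms(2)] by blast
    then have "D \<in> comp_map G X X -` A \<inter> comps G X \<longleftrightarrow> D \<in> A" for D
      using comp_map_same[OF assms(1), of D X] by (cases "D \<in> comps G X") (simp, blast)
    then show ?thesis by blast
  qed
  then have "(\<lambda>A. comp_map G X X -` A \<inter> comps G X) ` P = P" by simp
  then show ?thesis
    using partition_onD3[OF assms(2)] by (simp add: restrict_partition_image)
qed

lemma restrict_partition_partition:
  assumes "simple_graph G" "X \<subseteq> Y" "partition_on (comps G X) P" "finite P"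
  shows "partition_on (comps G Y) (restrict_partition G X P Y)"
    and "finite (restrict_partition G X P Y)"
proof -
  note eq = restrict_partition_image
  show "finite (restrict_partition G X P Y)" using assms(4) by (simp add: eq)
  show "partition_on (comps G Y) (restrict_partition G X P Y)"
  proof (rule partition_onI)
    show "\<Union>(restrict_partition G X P Y) = comps G Y"
    proof
      show "comps G Y \<subseteq> \<Union>(restrict_partition G X P Y)"
      proof
        fix D assume D: "D \<in> comps G Y"
        then have "comp_map G Y X D \<in> \<Union>P"
          using comp_map_in[OF assms(1,2)] partition_onD1[OF assms(3)] by blast
        then obtain A where A: "A \<in> P" "comp_map G Y X D \<in> A" by (rule UnionE)
        with D have "D \<in> comp_map G Y X -` A \<inter> comps G Y" by simp
        with A(1) show "D \<in> \<Union>(restrict_partition G X P Y)" unfolding eq by blast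
      qed
    qed (auto simp: eq)
    show "{} \<notin> restrict_partition G X P Y" by (simp add: eq)
    fix A B assume "A \<in> restrict_partition G X P Y" "B \<in> restrict_partition G X P Y" "A \<noteq> B"
    then show "disjnt A B"
      using disjointD[OF partition_onD2[OF assms(3)]] unfolding eq disjnt_def by blast
  qed
qed

lemma Gamma_iff: "(X, P) \<in> Gamma G \<longleftrightarrow>
    X \<in> finite_vertex_sets G \<and> finite P \<and> partition_on (comps G X) P"
  by (simp add: Gamma_def)

lemma Gamma_le_iff: "Gamma_le G (X, P) (Y, Q) \<longleftrightarrow>
    X \<subseteq> Y \<and> refines (comps G Y) Q (restrict_partition G X P Y)"
  by (simp add: Gamma_le_def)

lemma partition_bond_props:
  assumes "(X, P) \<in> Gamma G" "(Y, Q) \<in> Gamma G" "Gamma_le G (X, P) (Y, Q)" "C' \<in> Q"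
  shows "partition_bond G (Y, Q) (X, P) C' \<in> P"
    and "comp_map G Y X ` C' \<subseteq> partition_bond G (Y, Q) (X, P) C'"
  using theI'[OF partition_bond_ex1[OF assms(1-3), unfolded snd_conv fst_conv, OF assms(4)]]
  unfolding partition_bond_def by auto


section \<open>From tangles to choices of partition classes\<close>

definition chosen_block :: "'v graph \<Rightarrow> ('v set \<Rightarrow> ('v graph \<Rightarrow> real) \<Rightarrow> real)
    \<Rightarrow> 'v set \<times> 'v graph set set \<Rightarrow> 'v graph set" where
  "chosen_block G \<xi> = (\<lambda>(X, P)\<in>Gamma G. THE A. A \<in> P \<and> \<xi> X \<in> block_closure (comps G X) A)"

context
  fixes G :: "'v graph"
  assumes G: "simple_graph G"
begin

lemma tangle_component:
  assumes "\<xi> \<in> topspace (tangle_space G)" "X \<in> finite_vertex_sets G"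
  shows "\<xi> X \<in> topspace (stone_cech (discrete_topology (comps G X)))"
  using assms unfolding tangle_space_def topspace_inverse_limit by auto

lemma chosen_block_props:
  assumes "\<xi> \<in> topspace (tangle_space G)" "(X, P) \<in> Gamma G"
  shows "chosen_block G \<xi> (X, P) \<in> P"
    and "\<xi> X \<in> block_closure (comps G X) (chosen_block G \<xi> (X, P))"
proof -
  have "\<exists>!A. A \<in> P \<and> \<xi> X \<in> block_closure (comps G X) A"
    using assms by (intro block_closure_ex1 tangle_component) (auto simp: Gamma_iff)
  from theI'[OF this] show "chosen_block G \<xi> (X, P) \<in> P"
    "\<xi> X \<in> block_closure (comps G X) (chosen_block G \<xi> (X, P))"
    using assms(2) by (auto simp: chosen_block_def)
qed

lemma chosen_block_eqI:
  assumes "\<xi> \<in> topspace (tangle_space G)" "(X, P) \<in> Gamma G"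
    and "A \<in> P" "\<xi> X \<in> block_closure (comps G X) A"
  shows "chosen_block G \<xi> (X, P) = A"
proof -
  have "\<exists>!A. A \<in> P \<and> \<xi> X \<in> block_closure (comps G X) A"
    using assms by (intro block_closure_ex1 tangle_component) (auto simp: Gamma_iff)
  then show ?thesis using chosen_block_props[OF assms(1,2)] assms(3,4) by blast
qed

lemma chosen_block_in_partition_limit:
  assumes \<xi>: "\<xi> \<in> topspace (tangle_space G)"
  shows "chosen_block G \<xi> \<in> topspace (partition_limit G)"
  unfolding partition_limit_def topspace_inverse_limit
proof (intro CollectI conjI ballI impI)
  show "chosen_block G \<xi> \<in> (\<Pi>\<^sub>E \<gamma>\<in>Gamma G. topspace (discrete_topology (snd \<gamma>)))"
  proof (rule PiE_I)
    fix \<gamma> assume "\<gamma> \<in> Gamma G"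
    then show "chosen_block G \<xi> \<gamma> \<in> topspace (discrete_topology (snd \<gamma>))"
      using chosen_block_props(1)[OF \<xi>, of "fst \<gamma>" "snd \<gamma>"] by simp
  qed (simp add: chosen_block_def)
next
  fix \<gamma> \<gamma>' assume \<gamma>: "\<gamma> \<in> Gamma G" "\<gamma>' \<in> Gamma G" "Gamma_le G \<gamma> \<gamma>'"
  obtain X P Y Q where eq: "\<gamma> = (X, P)" "\<gamma>' = (Y, Q)" by (cases \<gamma>, cases \<gamma>')
  note le = \<gamma>[unfolded eq]
  have XY: "X \<subseteq> Y" "X \<in> finite_vertex_sets G" "Y \<in> finite_vertex_sets G"
    and Q: "partition_on (comps G Y) Q"
    using le by (auto simp: Gamma_iff Gamma_le_iff)
  let ?C = "chosen_block G \<xi> (Y, Q)" and ?D = "partition_bond G (Y, Q) (X, P)"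
  have C: "?C \<in> Q" "\<xi> Y \<in> block_closure (comps G Y) ?C"
    by (rule chosen_block_props[OF \<xi> le(2)])+
  have "\<xi> X = stone_cech_map (discrete_topology (comps G Y)) (discrete_topology (comps G X))
      (comp_map G Y X) (\<xi> Y)"
    using \<xi> XY unfolding tangle_space_def topspace_inverse_limit by auto
  also have "\<dots> \<in> block_closure (comps G X) (?D ?C)"
    using C partition_onD1[OF Q] partition_bond_props(2)[OF le C(1)]
    by (intro stone_cech_map_block_closure[OF comp_map_in[OF G XY(1)]]) auto
  finally show "partition_bond G \<gamma>' \<gamma> (chosen_block G \<xi> \<gamma>') = chosen_block G \<xi> \<gamma>"
    unfolding eq
    using chosen_block_eqI[OF \<xi> le(1) partition_bond_props(1)[OF le C(1)]] by simp
qed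

lemma continuous_map_chosen_block:
  "continuous_map (tangle_space G) (partition_limit G) (chosen_block G)"
proof -
  have "continuous_map (tangle_space G) (discrete_topology P) (\<lambda>\<xi>. chosen_block G \<xi> (X, P))"
    if XP: "(X, P) \<in> Gamma G" for X P
    unfolding continuous_map
  proof (intro conjI allI impI)
    show "(\<lambda>\<xi>. chosen_block G \<xi> (X, P)) ` topspace (tangle_space G)
        \<subseteq> topspace (discrete_topology P)"
      using chosen_block_props(1)[OF _ XP] by auto
    fix U assume "openin (discrete_topology P) U"
    then have "U \<subseteq> P" by simp
    have X: "X \<in> finite_vertex_sets G" and P: "comps G X = \<Union>P"
      using XP by (auto simp: Gamma_iff dest: partition_onD1)
    let ?W = "\<Union>A\<in>U. block_closure (comps G X) A"
    have "{\<xi> \<in> topspace (tangle_space G). chosen_block G \<xi> (X, P) \<in> U} =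
        {\<xi> \<in> topspace (tangle_space G). \<xi> X \<in> ?W}"
      using chosen_block_props(2)[OF _ XP] chosen_block_eqI[OF _ XP] \<open>U \<subseteq> P\<close> by blast
    moreover have "openin (stone_cech (discrete_topology (comps G X))) ?W"
      using \<open>U \<subseteq> P\<close> P by (intro openin_Union) (auto intro!: openin_block_closure)
    then have "openin (tangle_space G) {\<xi> \<in> topspace (tangle_space G). \<xi> X \<in> ?W}"
      unfolding tangle_space_def
      by (rule openin_continuous_map_preimage
          [OF continuous_map_inverse_limit_projection[OF X]])
    ultimately show
      "openin (tangle_space G) {\<xi> \<in> topspace (tangle_space G). chosen_block G \<xi> (X, P) \<in> U}"
      by simp
  qed
  then have "continuous_map (tangle_space G)
      (product_topology (\<lambda>\<gamma>. discrete_topology (snd \<gamma>)) (Gamma G)) (chosen_block G)"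
    unfolding continuous_map_componentwise by (auto simp: chosen_block_def)
  then show ?thesis
    using chosen_block_in_partition_limit
    unfolding partition_limit_def inverse_limit_def continuous_map_in_subtopology by auto
qed

lemma inj_on_chosen_block: "inj_on (chosen_block G) (topspace (tangle_space G))"
proof (rule inj_onI)
  fix \<xi> \<eta> assume \<xi>: "\<xi> \<in> topspace (tangle_space G)" and \<eta>: "\<eta> \<in> topspace (tangle_space G)"
    and eq: "chosen_block G \<xi> = chosen_block G \<eta>"
  show "\<xi> = \<eta>"
  proof (rule extensionalityI)
    show "\<xi> \<in> extensional (finite_vertex_sets G)" "\<eta> \<in> extensional (finite_vertex_sets G)"
      using \<xi> \<eta> unfolding tangle_space_def topspace_inverse_limit by (auto simp: PiE_def)
    fix X assume X: "X \<in> finite_vertex_sets G"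
    show "\<xi> X = \<eta> X"
    proof (rule eq_if_same_block_closures[OF tangle_component[OF \<xi> X] tangle_component[OF \<eta> X]])
      fix P assume "finite P" "partition_on (comps G X) P"
      with X have XP: "(X, P) \<in> Gamma G" by (simp add: Gamma_iff)
      show "\<exists>A\<in>P. \<xi> X \<in> block_closure (comps G X) A \<and> \<eta> X \<in> block_closure (comps G X) A"
        using chosen_block_props[OF \<xi> XP] chosen_block_props[OF \<eta> XP] eq by auto
    qed
  qed
qed

text \<open>At each \<open>X\<close> the chosen blocks
  determine a unique point, and the bonding maps respect these points: for a partition at \<open>X\<close>,
  pulled back to a larger \<open>Y\<close>, the bonding map from \<open>Y\<close> to \<open>X\<close> takes the block chosen from the
  pullback into the block chosen at \<open>X\<close>.\<close>

lemma chosen_block_surj: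
  assumes c: "c \<in> topspace (partition_limit G)"
  shows "c \<in> chosen_block G ` topspace (tangle_space G)"
proof -
  have cP: "c (X, P) \<in> P" if "(X, P) \<in> Gamma G" for X P
    using PiE_mem[OF _ that, of c "\<lambda>\<gamma>. topspace (discrete_topology (snd \<gamma>))"] c
    unfolding partition_limit_def topspace_inverse_limit by simp
  have bond: "partition_bond G (Y, Q) (X, P) (c (Y, Q)) = c (X, P)"
    if "(X, P) \<in> Gamma G" "(Y, Q) \<in> Gamma G" "Gamma_le G (X, P) (Y, Q)" for X P Y Q
    using c that unfolding partition_limit_def topspace_inverse_limit by blast
  have step: "comp_map G Y X ` c (Y, Q) \<subseteq> c (X, P)"
    if "(X, P) \<in> Gamma G" "(Y, Q) \<in> Gamma G" "Gamma_le G (X, P) (Y, Q)" for X P Y Q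
    using partition_bond_props(2)[OF that cP[OF that(2)]] bond[OF that] by simp
  have "\<exists>p. p \<in> topspace (stone_cech (discrete_topology (comps G X))) \<and>
      (\<forall>P. (X, P) \<in> Gamma G \<longrightarrow> p \<in> block_closure (comps G X) (c (X, P)))"
    if X: "X \<in> finite_vertex_sets G" for X
  proof (rule coherent_choice_realized[of "comps G X" "\<lambda>P. c (X, P)"])
    fix p assume "p \<in> topspace (stone_cech (discrete_topology (comps G X)))"
      "\<And>P. finite P \<Longrightarrow> partition_on (comps G X) P \<Longrightarrow>
        p \<in> block_closure (comps G X) (c (X, P))"
    then show ?thesis by (intro exI[of _ p]) (simp add: Gamma_iff)
  next
    show "c (X, P) \<in> P" if "finite P" "partition_on (comps G X) P" for P
      using cP that X by (simp add: Gamma_iff)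
    show "c (X, R) \<subseteq> c (X, P)" if fin: "finite P" "finite R" and ref: "refines (comps G X) R P"
      for P R
    proof -
      have P: "partition_on (comps G X) P" and R: "partition_on (comps G X) R"
        using ref by (auto simp: refines_def)
      have XP: "(X, P) \<in> Gamma G" and XR: "(X, R) \<in> Gamma G"
        using X fin P R by (auto simp: Gamma_iff)
      have "Gamma_le G (X, P) (X, R)"
        using ref by (simp add: Gamma_le_iff restrict_partition_same[OF G P])
      from step[OF XP XR this] have "comp_map G X X ` c (X, R) \<subseteq> c (X, P)" .
      moreover have "c (X, R) \<subseteq> comps G X" using cP[OF XR] partition_onD1[OF R] by auto
      then have "comp_map G X X ` c (X, R) = c (X, R)"
        using comp_map_same[OF G] by (simp add: subset_eq)
      ultimately show ?thesis by simp
    qed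
  qed
  then have "\<exists>p. \<forall>X\<in>finite_vertex_sets G.
      p X \<in> topspace (stone_cech (discrete_topology (comps G X))) \<and>
      (\<forall>P. (X, P) \<in> Gamma G \<longrightarrow> p X \<in> block_closure (comps G X) (c (X, P)))"
    by (intro bchoice) blast
  then obtain p where
    p: "\<And>X. X \<in> finite_vertex_sets G \<Longrightarrow>
          p X \<in> topspace (stone_cech (discrete_topology (comps G X)))"
    and pc: "\<And>X P. (X, P) \<in> Gamma G \<Longrightarrow> p X \<in> block_closure (comps G X) (c (X, P))"
    using Gamma_iff by blast
  define \<xi> where "\<xi> = restrict p (finite_vertex_sets G)"
  have \<xi>: "\<xi> \<in> topspace (tangle_space G)"
    unfolding tangle_space_def topspace_inverse_limit
  proof (intro CollectI conjI ballI impI)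
    show "\<xi> \<in> (\<Pi>\<^sub>E X\<in>finite_vertex_sets G.
        topspace (stone_cech (discrete_topology (comps G X))))"
      using p by (auto simp: \<xi>_def)
    fix X Y assume X: "X \<in> finite_vertex_sets G" and Y: "Y \<in> finite_vertex_sets G"
      and XY: "X \<subseteq> Y"
    let ?F = "stone_cech_map (discrete_topology (comps G Y)) (discrete_topology (comps G X))
        (comp_map G Y X)"
    have "?F (p Y) = p X"
    proof (rule eq_if_same_block_closures[OF _ p[OF X]])
      show "?F (p Y) \<in> topspace (stone_cech (discrete_topology (comps G X)))"
        using continuous_map_image_subset_topspace
          [OF stone_cech_map_discrete(1)[OF comp_map_in[OF G XY]]] p[OF Y] by blast
      fix P assume P: "finite P" "partition_on (comps G X) P"
      define Q where "Q = restrict_partition G X P Y"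
      have Q: "partition_on (comps G Y) Q" "finite Q"
        unfolding Q_def using restrict_partition_partition[OF G XY P(2,1)] by auto
      have XP: "(X, P) \<in> Gamma G" and YQ: "(Y, Q) \<in> Gamma G"
        using X Y P Q by (auto simp: Gamma_iff)
      have le: "Gamma_le G (X, P) (Y, Q)"
        using XY refines_refl[OF Q(1)] by (simp add: Gamma_le_iff Q_def)
      have "?F (p Y) \<in> block_closure (comps G X) (c (X, P))"
      proof (rule stone_cech_map_block_closure[OF comp_map_in[OF G XY] _ step[OF XP YQ le]
            pc[OF YQ]])
        show "c (Y, Q) \<subseteq> comps G Y" using cP[OF YQ] partition_onD1[OF Q(1)] by auto
      qed
      then show "\<exists>A\<in>P. ?F (p Y) \<in> block_closure (comps G X) A \<and>
          p X \<in> block_closure (comps G X) A"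
        using cP[OF XP] pc[OF XP] by blast
    qed
    then show "?F (\<xi> Y) = \<xi> X" using X Y by (simp add: \<xi>_def)
  qed
  have "chosen_block G \<xi> = c"
  proof (rule extensionalityI)
    show "chosen_block G \<xi> \<in> extensional (Gamma G)" by (simp add: chosen_block_def)
    show "c \<in> extensional (Gamma G)"
      using c unfolding partition_limit_def topspace_inverse_limit by (auto simp: PiE_def)
    fix \<gamma> assume "\<gamma> \<in> Gamma G"
    moreover obtain X P where "\<gamma> = (X, P)" by (cases \<gamma>)
    ultimately have XP: "(X, P) \<in> Gamma G" and eq: "\<gamma> = (X, P)" by auto
    have "\<xi> X = p X" using XP by (simp add: \<xi>_def Gamma_iff)
    then show "chosen_block G \<xi> \<gamma> = c \<gamma>"
      unfolding eq using pc[OF XP] by (intro chosen_block_eqI[OF \<xi> XP cP[OF XP]]) simp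
  qed
  with \<xi> show ?thesis by blast
qed

lemma compact_space_tangle_space: "compact_space (tangle_space G)"
  unfolding tangle_space_def
  by (intro compact_space_inverse_limit compact_space_stone_cech Hausdorff_space_stone_cech
      stone_cech_map_discrete(1) comp_map_in G)

lemma Hausdorff_space_partition_limit: "Hausdorff_space (partition_limit G)"
  unfolding partition_limit_def by (rule Hausdorff_space_inverse_limit) simp

end

theorem theorem3p3:
  fixes G :: "'v graph"
  assumes "simple_graph G" and "connected_graph G" and "infinite (verts G)"
  shows "tangle_space G homeomorphic_space partition_limit G"
proof (rule homeomorphic_map_imp_homeomorphic_space, rule continuous_imp_homeomorphic_map)
  note G = assms(1)
  show "continuous_map (tangle_space G) (partition_limit G) (chosen_block G)"
    by (rule continuous_map_chosen_block[OF G])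
  show "compact_space (tangle_space G)" by (rule compact_space_tangle_space[OF G])
  show "Hausdorff_space (partition_limit G)" by (rule Hausdorff_space_partition_limit[OF G])
  show "chosen_block G ` topspace (tangle_space G) = topspace (partition_limit G)"
    using chosen_block_in_partition_limit[OF G] chosen_block_surj[OF G] by blast
  show "inj_on (chosen_block G) (topspace (tangle_space G))"
    by (rule inj_on_chosen_block[OF G])
qed

end
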